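(* For any two Cauchy sequences of rational numbers $\{x^{(n)}\}_{n\in\mathbb N}$, $\{y^{(n)}\}_{n\in\mathbb N}$, $$\kappa\big(\{x^{(n)}\}_{n\in\mathbb N}\,\widehat{\boxtimes}\,\{y^{(n)}\}_{n\in\mathbb N}\big)=\kappa\big(\{x^{(n)}\}_{n\in\mathbb N}\big)\,\widehat{\otimes}\,\kappa\big(\{y^{(n)}\}_{n\in\mathbb N}\big).$$
   Context: $\mathbb N=\{1,2,3,\dots\}$ and $\mathcal Z_{10}=\{0,1,\dots,9\}$. $\mathcal R$ is the set of all formal decimals $x=x_0.x_1x_2x_3\cdots$ with $x_0\in\mathbb Z$ and $x_k\in\mathcal Z_{10}$ for $k\in\mathbb N$; two elements are equal iff all their digits agree. For $k\in\mathbb N$, $[x]_k=\sum_{i=0}^k x_i10^{-i}\in\mathbb Q$. Order on $\mathcal R$: $x\preceq y$ iff $[x]_k\le [y]_k$ for all $k\in\mathbb N$. Every nonempty bounded above (below) subset of $(\mathcal R,\preceq)$ has a supremum (infimum). $x\sim y$ ("no gap") means that there is no $z\in\mathcal R\setminus\{x,y\}$ lying strictly between $x$ and $y$ with respect to $\preceq$; $\sim$ is an equivalence relation, $\mathbb R:=\mathcal R/\sim$, and $[x]$ denotes the class of $x$. $\mathbb Q$ is regarded as a subset of $\mathcal R$ via long division: $\alpha=q/p$ ($p\in\mathbb N$, $q\in\mathbb Z$) is identified with $\alpha_0.\alpha_1\alpha_2\cdots$, where $\alpha_0=\lfloor q/p\rfloor$, $\beta_0=q-\alpha_0p$, $\alpha_{k+1}=\lfloor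 10\beta_k/p\rfloor$, $\beta_{k+1}=10\beta_k-\alpha_{k+1}p$. For a bounded sequence $\{x^{(n)}\}_{n\in\mathbb N}$ in $\mathcal R$: $\overline{\mathrm{LIMIT}}(\{x^{(n)}\})=\inf\{\sup\{x^{(k)}: k\ge n\}: n\in\mathbb N\}$ and $\underline{\mathrm{LIMIT}}(\{x^{(n)}\})=\sup\{\inf\{x^{(k)}: k\ge n\}: n\in\mathbb N\}$, with $\sup$, $\inf$ taken in $(\mathcal R,\preceq)$; if they are equal, the common value is denoted $\mathrm{LIMIT}(\{x^{(n)}\})$. It exists for bounded monotone sequences. On $\mathcal R$: $\Psi(x_0.x_1x_2x_3\cdots)=(-1-x_0).(9-x_1)(9-x_2)(9-x_3)\cdots$; $\Psi^{(k)}$ is the $k$-fold composite ($\Psi^{(0)}=\mathrm{id}$); $\|x\|=\max\{x,\Psi(x)\}$; $\mathrm{sign}(x)=0$ if $x\succeq 0.000000\cdots$ and $\mathrm{sign}(x)=1$ if $x\preceq(-1).999999\cdots$. Multiplication: $x\otimes y=\Psi^{(\mathrm{sign}(x)+\mathrm{sign}(y))}\big(\mathrm{LIMIT}(\{[\|x\|]_k\cdot[\|y\|]_k\}_{k\in\mathbb N})\big)$, products taken in $\mathbb Q$. It respects $\sim$, and $[x]\,\widehat\otimes\,[y]:=[x\otimes y]$ on $\mathbb R$. A sequence of rational numbers $\{x^{(n)}\}_{n\in\mathbb N}$ is Cauchy if for every rational $\epsilon>0$ there is $N\in\mathbb N$ such that $|x^{(m)}-x^{(n)}|<\epsilon$ for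 all $m,n\ge N$. $\mathbf{CR}$ is the set of all such sequences. For every Cauchy sequence of rationals the lower and upper limits are $\sim$-equivalent, and $\kappa:\mathbf{CR}\to\mathcal R/\sim$ is defined by $\kappa(\{x^{(n)}\})=[\underline{\mathrm{LIMIT}}(\{x^{(n)}\})]=[\overline{\mathrm{LIMIT}}(\{x^{(n)}\})]$. Multiplication of Cauchy sequences is termwise: $\{x^{(n)}\}\,\widehat\boxtimes\,\{y^{(n)}\}=\{x^{(n)}\cdot y^{(n)}\}$ (product in $\mathbb Q$), which is again Cauchy. *)

theory Defs
  imports Complex_Main
begin

section \<open>Formal decimals\<close>

text \<open>The integer part is the digit with index 0.  It may be negative, and the
  digits after the point always count positively: \<open>(-1).999...\<close> sits just below \<open>0.000...\<close>.\<close>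

typedef decimal = "{x :: nat \<Rightarrow> int. \<forall>k\<ge>1. x k \<in> {0..9}}"
  morphisms digit Abs_decimal
  by (rule exI[of _ "\<lambda>_. 0"]) simp

setup_lifting type_definition_decimal

definition trunc :: "decimal \<Rightarrow> nat \<Rightarrow> rat" where
  "trunc x k = (\<Sum>i\<le>k. of_int (digit x i) / 10 ^ i)"

lemma decimal_eqI: "(\<And>k. digit x k = digit y k) \<Longrightarrow> x = y"
  by (simp add: digit_inject[symmetric] fun_eq_iff)

lemma digit_bounds: "0 \<le> digit x (Suc k)" "digit x (Suc k) \<le> 9"
  using digit[of x] by auto

primrec scaled :: "decimal \<Rightarrow> nat \<Rightarrow> int" where
  "scaled x 0 = digit x 0"
| "scaled x (Suc k) = 10 * scaled x k + digit x (Suc k)"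

lemma trunc_scaled: "trunc x k = of_int (scaled x k) / 10 ^ k"
  by (induction k) (simp_all add: trunc_def field_simps)

lemma scaled_div: "scaled x (Suc k) div 10 = scaled x k"
  using digit_bounds[of x k] by simp

lemma scaled_inj: "(\<And>k. scaled x k = scaled y k) \<Longrightarrow> x = y"
proof (rule decimal_eqI)
  fix k assume *: "\<And>k. scaled x k = scaled y k"
  show "digit x k = digit y k"
    using *[of k] *[of "k - 1"] by (cases k) auto
qed

lemma scaled_exists:
  assumes "\<And>k. T (Suc k) div 10 = T k"
  obtains x where "\<And>k. scaled x k = T k"
proof -
  define f where "f k = (if k = 0 then T 0 else T k mod 10)" for k
  have f: "digit (Abs_decimal f) = f"
    by (rule Abs_decimal_inverse) (auto simp: f_def)
  have "scaled (Abs_decimal f) k = T k" for k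
  proof (induction k)
    case 0
    then show ?case by (simp add: f) (simp add: f_def)
  next
    case (Suc k)
    then show ?case using div_mult_mod_eq[of "T (Suc k)" 10] assms[of k]
      by (simp add: f) (simp add: f_def)
  qed
  then show thesis by (rule that)
qed

section \<open>Order\<close>

instantiation decimal :: order
begin

definition less_eq_decimal :: "decimal \<Rightarrow> decimal \<Rightarrow> bool" where
  "x \<le> y \<longleftrightarrow> (\<forall>k\<ge>1. trunc x k \<le> trunc y k)"

definition less_decimal :: "decimal \<Rightarrow> decimal \<Rightarrow> bool" where
  "(x :: decimal) < y \<longleftrightarrow> x \<le> y \<and> x \<noteq> y"

lemma le_decimal_iff: "(x :: decimal) \<le> y \<longleftrightarrow> (\<forall>k. scaled x k \<le> scaled y k)"
proof -
  have "trunc x k \<le> trunc y k \<longleftrightarrow> scaled x k \<le> scaled y k" for k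
    by (simp add: trunc_scaled divide_le_cancel)
  moreover have "scaled x 0 \<le> scaled y 0" if "scaled x 1 \<le> scaled y 1"
    using zdiv_mono1[OF that, of 10] scaled_div[of x 0] scaled_div[of y 0] by simp
  moreover have "k = 0 \<or> k \<ge> 1" for k :: nat by linarith
  ultimately show ?thesis
    unfolding less_eq_decimal_def by (metis order_refl)
qed

instance
proof
  fix x y z :: decimal
  show antisym: "x \<le> y \<Longrightarrow> y \<le> x \<Longrightarrow> x = y"
    by (rule scaled_inj) (simp add: le_decimal_iff order_antisym)
  then show "x < y \<longleftrightarrow> x \<le> y \<and> \<not> y \<le> x"
    by (auto simp: less_decimal_def le_decimal_iff)
  show "x \<le> x" by (simp add: le_decimal_iff)
  show "x \<le> y \<Longrightarrow> y \<le> z \<Longrightarrow> x \<le> z" by (meson le_decimal_iff order_trans)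
qed

end

lemma scaled_less_propagate:
  assumes "scaled x k < scaled y k" and "k \<le> j"
  shows "scaled x j < scaled y j"
  using assms(2)
proof (induction j rule: dec_induct)
  case (step j)
  then show ?case using digit_bounds[of x j] digit_bounds[of y j] by simp
qed (use assms(1) in simp)

lemma scaled_le_down:
  assumes "scaled x j \<le> scaled y j" and "k \<le> j"
  shows "scaled x k \<le> scaled y k"
  using scaled_less_propagate[of y k x j] assms by linarith

instance decimal :: linorder
proof
  fix x y :: decimal
  show "x \<le> y \<or> y \<le> x"
    unfolding le_decimal_iff
    by (metis linorder_not_le linorder_le_cases scaled_le_down order_less_imp_le)
qed

text \<open>Long division of \<open>q\<close> by \<open>p\<close>; on \<^typ>\<open>int\<close>, \<open>div\<close> rounds towards minus infinity.\<close>

primrec ld_remainder :: "int \<Rightarrow> nat \<Rightarrow> nat \<Rightarrow> int" where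
  "ld_remainder q p 0 = q - (q div int p) * int p"
| "ld_remainder q p (Suc k) =
     10 * ld_remainder q p k - (10 * ld_remainder q p k div int p) * int p"

primrec ld_digit :: "int \<Rightarrow> nat \<Rightarrow> nat \<Rightarrow> int" where
  "ld_digit q p 0 = q div int p"
| "ld_digit q p (Suc k) = 10 * ld_remainder q p k div int p"

lemma ld_remainder_bounds:
  assumes "p > 0"
  shows "0 \<le> ld_remainder q p k \<and> ld_remainder q p k < int p"
  using assms by (cases k) (simp_all add: minus_div_mult_eq_mod)

lift_definition long_division :: "int \<Rightarrow> nat \<Rightarrow> decimal" is ld_digit
proof -
  fix q :: int and p k :: nat
  assume "1 \<le> k"
  then obtain j where j: "k = Suc j" by (cases k) auto
  show "ld_digit q p k \<in> {0..9}"
  proof (cases "p = 0")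
    case False
    then have "0 \<le> ld_remainder q p j" "ld_remainder q p j < int p" "0 < int p"
      using ld_remainder_bounds[of p q j] by auto
    moreover have "10 * ld_remainder q p j div int p < 10"
    proof -
      have "10 * ld_remainder q p j + (- 10) * int p < 0" using calculation by simp
      then have "(10 * ld_remainder q p j + (- 10) * int p) div int p < 0"
        using calculation pos_imp_zdiv_neg_iff by blast
      then show ?thesis
        using div_mult_self1[of "int p" "10 * ld_remainder q p j" "- 10"] False by linarith
    qed
    ultimately show ?thesis by (simp add: j pos_imp_zdiv_nonneg_iff)
  qed (simp add: j)
qed

text \<open>The choice of the fraction is immaterial, see \<open>decimal_of_rat_divide\<close>.\<close>

definition decimal_of_rat :: "rat \<Rightarrow> decimal" where
  "decimal_of_rat r = long_division (fst (quotient_of r)) (nat (snd (quotient_of r)))"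

lemma long_division_scaled:
  assumes "p > 0"
  shows "scaled (long_division q p) k * int p + ld_remainder q p k = 10 ^ k * q"
proof (induction k)
  case (Suc k)
  then show ?case by (simp add: long_division.rep_eq algebra_simps)
qed (simp add: long_division.rep_eq)

lemma scaled_long_division:
  assumes "p > 0"
  shows "scaled (long_division q p) k = \<lfloor>10 ^ k * (of_int q / of_nat p :: rat)\<rfloor>"
proof -
  have "(10 ^ k * q) div int p = scaled (long_division q p) k"
    using long_division_scaled[OF assms, of q k] ld_remainder_bounds[OF assms, of q k]
    by (intro int_div_pos_eq[where r = "ld_remainder q p k"]) (auto simp: mult.commute)
  then show ?thesis
    using floor_divide_of_int_eq[where 'a = rat, of "10 ^ k * q" "int p"] by simp
qed

lemma decimal_of_rat_divide:
  assumes "p > 0"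
  shows "decimal_of_rat (of_int q / of_nat p) = long_division q p"
proof -
  define r :: rat where "r = of_int q / of_nat p"
  obtain a b where ab: "quotient_of r = (a, b)" by force
  then have "b > 0" "r = of_int a / of_int b"
    using quotient_of_denom_pos quotient_of_div by blast+
  then have "scaled (decimal_of_rat r) k = scaled (long_division q p) k" for k
    using ab assms by (simp add: decimal_of_rat_def scaled_long_division r_def)
  then show ?thesis unfolding r_def[symmetric] by (rule scaled_inj)
qed

lemma scaled_decimal_of_rat: "scaled (decimal_of_rat r) k = \<lfloor>10 ^ k * r\<rfloor>"
proof -
  obtain a b where ab: "quotient_of r = (a, b)" by force
  then have "b > 0" "r = of_int a / of_int b"
    using quotient_of_denom_pos quotient_of_div by blast+
  then show ?thesis using ab by (simp add: decimal_of_rat_def scaled_long_division)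
qed

lemma decimal_of_rat_mono: "q \<le> r \<Longrightarrow> decimal_of_rat q \<le> decimal_of_rat r"
  by (simp add: le_decimal_iff scaled_decimal_of_rat floor_mono)

lemma decimal_lub_exists:
  fixes A :: "decimal set"
  assumes "A \<noteq> {}" and "bdd_above A"
  obtains s where "\<And>a. a \<in> A \<Longrightarrow> a \<le> s" and "\<And>u. (\<And>a. a \<in> A \<Longrightarrow> a \<le> u) \<Longrightarrow> s \<le> u"
proof -
  obtain B where B: "\<And>a. a \<in> A \<Longrightarrow> a \<le> B" using assms(2) by (auto simp: bdd_above_def)
  have bdd: "bdd_above ((\<lambda>a. scaled a k) ` A)" for k
    using B by (intro bdd_aboveI[of _ "scaled B k"]) (auto simp: le_decimal_iff)
  define T where "T k = (SUP a\<in>A. scaled a k)" for k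
  have upper: "scaled a k \<le> T k" if "a \<in> A" for a k
    unfolding T_def using that bdd by (rule cSUP_upper)
  have least: "T k \<le> u" if "\<And>a. a \<in> A \<Longrightarrow> scaled a k \<le> u" for k u
    unfolding T_def using assms(1) that by (rule cSUP_least)
  have "T (Suc k) div 10 = T k" for k
  proof (rule antisym)
    have "T (Suc k) \<le> 10 * T k + 9"
    proof (rule least)
      fix a assume "a \<in> A"
      then show "scaled a (Suc k) \<le> 10 * T k + 9"
        using upper[of a k] digit_bounds[of a k] by simp
    qed
    then show "T (Suc k) div 10 \<le> T k" by linarith
    show "T k \<le> T (Suc k) div 10"
    proof (rule least)
      fix a assume "a \<in> A"
      then show "scaled a k \<le> T (Suc k) div 10"
        using zdiv_mono1[OF upper[of a "Suc k"], of 10] scaled_div[of a k] by simp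
    qed
  qed
  then obtain s where s: "\<And>k. scaled s k = T k" by (rule scaled_exists) auto
  show thesis
  proof (rule that[of s])
    show "a \<le> s" if "a \<in> A" for a using upper[OF that] by (simp add: le_decimal_iff s)
    show "s \<le> u" if "\<And>a. a \<in> A \<Longrightarrow> a \<le> u" for u
      using that by (auto simp: le_decimal_iff s intro: least)
  qed
qed

instantiation decimal :: conditionally_complete_linorder
begin

definition Sup_decimal :: "decimal set \<Rightarrow> decimal" where
  "Sup (A :: decimal set) = (LEAST s. \<forall>a\<in>A. a \<le> s)"

definition Inf_decimal :: "decimal set \<Rightarrow> decimal" where
  "Inf (A :: decimal set) = (GREATEST s. \<forall>a\<in>A. s \<le> a)"

definition sup_decimal :: "decimal \<Rightarrow> decimal \<Rightarrow> decimal" where "sup_decimal = max"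

definition inf_decimal :: "decimal \<Rightarrow> decimal \<Rightarrow> decimal" where "inf_decimal = min"

instance
proof
  fix x y z :: decimal and A :: "decimal set"
  show "inf x y \<le> x" "inf x y \<le> y" "x \<le> sup x y" "y \<le> sup x y"
    by (simp_all add: inf_decimal_def sup_decimal_def)
  show "x \<le> y \<Longrightarrow> x \<le> z \<Longrightarrow> x \<le> inf y z" by (simp add: inf_decimal_def)
  show "y \<le> x \<Longrightarrow> z \<le> x \<Longrightarrow> sup y z \<le> x" by (simp add: sup_decimal_def)
  have Sup: "Sup A = s" if "\<And>a. a \<in> A \<Longrightarrow> a \<le> s" "\<And>u. (\<And>a. a \<in> A \<Longrightarrow> a \<le> u) \<Longrightarrow> s \<le> u"
    for s and A :: "decimal set"
    unfolding Sup_decimal_def by (rule Least_equality) (use that in auto)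
  have Inf: "Inf A = s" if "\<And>a. a \<in> A \<Longrightarrow> s \<le> a" "\<And>u. (\<And>a. a \<in> A \<Longrightarrow> u \<le> a) \<Longrightarrow> u \<le> s"
    for s and A :: "decimal set"
    unfolding Inf_decimal_def by (rule Greatest_equality) (use that in auto)
  show "x \<le> Sup A" if "x \<in> A" "bdd_above A"
  proof -
    from that have "A \<noteq> {}" by auto
    then show ?thesis using that Sup by (metis decimal_lub_exists)
  qed
  show "Sup A \<le> z" if "A \<noteq> {}" "\<And>x. x \<in> A \<Longrightarrow> x \<le> z"
  proof -
    from that(2) have "bdd_above A" by (rule bdd_aboveI)
    with that show ?thesis using Sup by (metis decimal_lub_exists)
  qed
  have glb: "\<exists>s. (\<forall>a\<in>A. s \<le> a) \<and> (\<forall>u. (\<forall>a\<in>A. u \<le> a) \<longrightarrow> u \<le> s)"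
    if ne: "A \<noteq> {}" and b: "bdd_below A" for A :: "decimal set"
  proof -
    define L where "L = {u. \<forall>a\<in>A. u \<le> a}"
    have "L \<noteq> {}" using b by (auto simp: L_def bdd_below_def)
    moreover have "bdd_above L" using ne by (auto simp: L_def bdd_above_def)
    ultimately obtain s where s: "\<And>a. a \<in> L \<Longrightarrow> a \<le> s"
      "\<And>u. (\<And>a. a \<in> L \<Longrightarrow> a \<le> u) \<Longrightarrow> s \<le> u"
      by (rule decimal_lub_exists) blast
    then show ?thesis by (intro exI[of _ s]) (auto simp: L_def)
  qed
  show "Inf A \<le> x" if x: "x \<in> A" "bdd_below A"
  proof -
    obtain s where s: "\<forall>a\<in>A. s \<le> a" "\<forall>u. (\<forall>a\<in>A. u \<le> a) \<longrightarrow> u \<le> s"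
      using glb[of A] x by auto
    then have "Inf A = s" by (intro Inf) auto
    with s x show ?thesis by auto
  qed
  show "z \<le> Inf A" if x: "A \<noteq> {}" "\<And>x. x \<in> A \<Longrightarrow> z \<le> x"
  proof -
    obtain s where s: "\<forall>a\<in>A. s \<le> a" "\<forall>u. (\<forall>a\<in>A. u \<le> a) \<longrightarrow> u \<le> s"
      using glb[of A] x by (auto simp: bdd_below_def)
    then have "Inf A = s" by (intro Inf) auto
    with s x show ?thesis by auto
  qed
qed

end

section \<open>The quotient by the no-gap relation\<close>

definition no_gap :: "decimal \<Rightarrow> decimal \<Rightarrow> bool" where
  "no_gap x y \<longleftrightarrow> \<not> (\<exists>z. z \<noteq> x \<and> z \<noteq> y \<and> (x < z \<and> z < y \<or> y < z \<and> z < x))"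

text \<open>The value of a decimal as an element of the library's \<^typ>\<open>real\<close>.  It occurs in no
  definition below; it only serves to prove that these are well-defined.\<close>

definition val :: "decimal \<Rightarrow> real" where
  "val x = (SUP k. of_int (scaled x k) / 10 ^ k)"

lemma val_bounds:
  "of_int (scaled x k) \<le> val x * 10 ^ k" "val x * 10 ^ k \<le> of_int (scaled x k) + 1"
proof -
  let ?u = "\<lambda>k. of_int (scaled x k) / 10 ^ k :: real"
  let ?v = "\<lambda>k. (of_int (scaled x k) + 1) / 10 ^ k :: real"
  have u: "incseq ?u"
  proof (rule incseq_SucI)
    fix n
    have "10 * real_of_int (scaled x n) \<le> of_int (scaled x (Suc n))"
      using digit_bounds[of x n] by simp
    then show "?u n \<le> ?u (Suc n)" by (simp add: field_simps)
  qed
  have v: "decseq ?v"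
  proof (rule decseq_SucI)
    fix n
    have "real_of_int (scaled x (Suc n)) + 1 \<le> 10 * (of_int (scaled x n) + 1)"
      using digit_bounds[of x n] by simp
    then show "?v (Suc n) \<le> ?v n" by (simp add: field_simps)
  qed
  have uv: "?u i \<le> ?v j" for i j
  proof -
    have "?u i \<le> ?u (max i j)" by (rule incseqD[OF u]) simp
    also have "\<dots> \<le> ?v (max i j)" by (simp add: divide_right_mono)
    also have "\<dots> \<le> ?v j" by (rule decseqD[OF v]) simp
    finally show ?thesis .
  qed
  have "?u k \<le> val x"
    unfolding val_def using uv[of _ 0] by (intro cSUP_upper bdd_aboveI[of _ "?v 0"]) auto
  then show "of_int (scaled x k) \<le> val x * 10 ^ k" by (simp add: field_simps)
  have "val x \<le> ?v k" unfolding val_def using uv by (intro cSUP_least) auto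
  then show "val x * 10 ^ k \<le> of_int (scaled x k) + 1" by (simp add: field_simps)
qed

lemma small_power:
  fixes d :: real
  assumes "\<And>k. d * 10 ^ k \<le> 1"
  shows "d \<le> 0"
proof (rule ccontr)
  assume "\<not> d \<le> 0"
  moreover obtain n where "1 / d < 10 ^ n" using real_arch_pow[of 10 "1 / d"] by auto
  ultimately show False using assms[of n] by (simp add: field_simps)
qed

lemma val_eqI:
  assumes "\<And>k. of_int (scaled x k) \<le> r * 10 ^ k" "\<And>k. r * 10 ^ k \<le> of_int (scaled x k) + 1"
  shows "val x = r"
proof (rule antisym)
  have "(val x - r) * 10 ^ k \<le> 1" "(r - val x) * 10 ^ k \<le> 1" for k
    using val_bounds[of x k] assms[of k] by (simp_all add: left_diff_distrib)
  then have "val x - r \<le> 0" "r - val x \<le> 0" using small_power by blast+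
  then show "val x \<le> r" "r \<le> val x" by simp_all
qed

lemma val_mono: "x \<le> y \<Longrightarrow> val x \<le> val y"
proof -
  assume le: "x \<le> y"
  have "(val x - val y) * 10 ^ k \<le> 1" for k
  proof -
    have "real_of_int (scaled x k) \<le> of_int (scaled y k)" using le by (simp add: le_decimal_iff)
    then show ?thesis
      using val_bounds[of x k] val_bounds[of y k] by (simp add: left_diff_distrib)
  qed
  then show ?thesis using small_power[of "val x - val y"] by simp
qed

lemma val_less: "val x < val y \<Longrightarrow> x < y"
  using val_mono[of y x] by (meson linorder_not_le)

lemma val_surj: obtains x where "val x = r"
proof -
  have "\<lfloor>r * 10 ^ Suc k\<rfloor> div 10 = \<lfloor>r * 10 ^ k\<rfloor>" for k
    using floor_divide_real_eq_div[of 10 "r * 10 ^ Suc k"] by simp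
  then obtain x where x: "\<And>k. scaled x k = \<lfloor>r * 10 ^ k\<rfloor>" by (rule scaled_exists) auto
  have "val x = r" by (rule val_eqI) (simp_all add: x)
  then show thesis by (rule that)
qed

lemma no_gap_iff_val: "no_gap x y \<longleftrightarrow> val x = val y"
proof
  have *: "\<not> no_gap x y \<and> \<not> no_gap y x" if less: "val x < val y" for x y
  proof -
    obtain r where "val x < r" "r < val y" using dense[OF less] by blast
    moreover obtain z where "val z = r" by (rule val_surj)
    ultimately have "x < z" "z < y" by (simp_all add: val_less)
    then show ?thesis by (auto simp: no_gap_def)
  qed
  show "no_gap x y \<Longrightarrow> val x = val y" using *[of x y] *[of y x] by linarith
next
  have *: "\<exists>k. \<forall>j\<ge>k. of_int (scaled y j) = val y * 10 ^ j \<and> of_int (scaled x j) + 1 = val x * 10 ^ j"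
    if "x < y" "val x = val y" for x y
  proof -
    from that(1) have "\<not> y \<le> x" by simp
    then obtain k where k: "scaled x k < scaled y k"
      by (auto simp: le_decimal_iff not_le)
    have "of_int (scaled y j) = val y * 10 ^ j \<and> of_int (scaled x j) + 1 = val x * 10 ^ j"
      if "j \<ge> k" for j
    proof -
      have "scaled x j + 1 \<le> scaled y j" using scaled_less_propagate[OF k that] by simp
      then have "real_of_int (scaled x j) + 1 \<le> of_int (scaled y j)" by linarith
      then show ?thesis
        using val_bounds[of x j] val_bounds[of y j] \<open>val x = val y\<close> by simp
    qed
    then show ?thesis by blast
  qed
  have **: False if "val x = val y" "x < z" "z < y" for x y z
  proof -
    have "val x \<le> val z" "val z \<le> val y"
      using that(2,3) by (simp_all add: val_mono)
    with that(1) have "val x = val z" "val z = val y" by linarith+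
    with *[of x z] *[of z y] that obtain k l where
      "\<forall>j\<ge>k. real_of_int (scaled z j) = val z * 10 ^ j"
      "\<forall>j\<ge>l. real_of_int (scaled z j) + 1 = val z * 10 ^ j"
      by blast
    from this(1)[rule_format, of "max k l"] this(2)[rule_format, of "max k l"]
    show False by simp
  qed
  show "val x = val y \<Longrightarrow> no_gap x y" using **[of x y] **[of y x] unfolding no_gap_def by auto
qed

quotient_type dreal = decimal / no_gap
  morphisms rep_dreal class_of
  by (rule equivpI) (auto simp: no_gap_iff_val reflp_def symp_def transp_def)

section \<open>Upper and lower limits\<close>

text \<open>Sequences are indexed by the positive integers; the entry at index 0 is ignored
  throughout.\<close>

definition upper_LIMIT :: "(nat \<Rightarrow> decimal) \<Rightarrow> decimal" where
  "upper_LIMIT s = (INF n\<in>{1..}. SUP k\<in>{n..}. s k)"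

definition lower_LIMIT :: "(nat \<Rightarrow> decimal) \<Rightarrow> decimal" where
  "lower_LIMIT s = (SUP n\<in>{1..}. INF k\<in>{n..}. s k)"

definition LIMIT :: "(nat \<Rightarrow> decimal) \<Rightarrow> decimal" where
  "LIMIT s = (THE z. z = upper_LIMIT s \<and> z = lower_LIMIT s)"

lemma LIMIT_eq: "upper_LIMIT s = lower_LIMIT s \<Longrightarrow> LIMIT s = lower_LIMIT s"
  by (simp add: LIMIT_def)

lemma LIMIT_incseq:
  assumes mono: "\<And>m n. 1 \<le> m \<Longrightarrow> m \<le> n \<Longrightarrow> s m \<le> s n" and bdd: "bdd_above (s ` {1..})"
  shows "upper_LIMIT s = lower_LIMIT s"
proof -
  have inf: "(INF k\<in>{n..}. s k) = s n" if "n \<ge> 1" for n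
    by (rule cInf_eq_minimum) (auto intro: mono[OF that])
  have sup: "(SUP k\<in>{n..}. s k) = (SUP k\<in>{1..}. s k)" if "n \<ge> 1" for n
  proof (rule antisym)
    show "(SUP k\<in>{n..}. s k) \<le> (SUP k\<in>{1..}. s k)"
      by (rule cSUP_subset_mono) (use that bdd in auto)
    show "(SUP k\<in>{1..}. s k) \<le> (SUP k\<in>{n..}. s k)"
    proof (rule cSUP_mono)
      show "bdd_above (s ` {n..})" using that by (intro bdd_above_mono[OF bdd]) auto
      fix k :: nat assume "k \<in> {1..}"
      then show "\<exists>m\<in>{n..}. s k \<le> s m" by (intro bexI[of _ "max k n"] mono) auto
    qed simp
  qed
  have "upper_LIMIT s = (INF n\<in>{1::nat..}. SUP k\<in>{1..}. s k)"
    unfolding upper_LIMIT_def by (rule INF_cong[OF refl], rule sup) simp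
  also have "\<dots> = (SUP k\<in>{1..}. s k)" by (rule cINF_const) simp
  also have "\<dots> = lower_LIMIT s"
    unfolding lower_LIMIT_def by (rule SUP_cong[OF refl], rule inf[symmetric]) simp
  finally show ?thesis .
qed

lemma val_LIMIT:
  assumes "(\<lambda>n. val (s n)) \<longlonglongrightarrow> L"
  shows "bdd_above (s ` A)" and "val (lower_LIMIT s) = L" and "val (upper_LIMIT s) = L"
proof -
  obtain K where K: "\<And>n. \<bar>val (s n)\<bar> \<le> K"
    using convergent_imp_Bseq[of "\<lambda>n. val (s n)"] assms
    by (auto simp: convergent_def Bseq_def)
  obtain B C where BC: "val B = K + 1" "val C = - K - 1" by (metis val_surj)
  have B: "s n \<le> B" and C: "C \<le> s n" for n
    using K[of n] by (intro order_less_imp_le val_less; simp add: BC)+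
  show bdda: "bdd_above (s ` A)" for A using B by (intro bdd_aboveI[of _ B]) auto
  have bddb: "bdd_below (s ` A)" for A using C by (intro bdd_belowI[of _ C]) auto
  have Inf_le: "(INF k\<in>{n..}. s k) \<le> s k" if "n \<le> k" for n k
    using that bddb by (intro cINF_lower) auto
  have Sup_ge: "s k \<le> (SUP k\<in>{n..}. s k)" if "n \<le> k" for n k
    using that bdda by (intro cSUP_upper) auto
  have main: "L - e \<le> val (lower_LIMIT s) \<and> val (lower_LIMIT s) \<le> L + e \<and>
              L - e \<le> val (upper_LIMIT s) \<and> val (upper_LIMIT s) \<le> L + e" if "e > 0" for e
  proof -
    from LIMSEQ_D[OF assms that] obtain N where N: "\<And>n. n \<ge> N \<Longrightarrow> \<bar>val (s n) - L\<bar> < e"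
      by auto
    define M where "M = max N 1"
    obtain a b where ab: "val a = L - e" "val b = L + e" by (metis val_surj)
    have a: "a \<le> s n" and b: "s n \<le> b" if "n \<ge> M" for n
      using that N[of n] unfolding M_def
      by (intro order_less_imp_le val_less; simp add: ab)+
    have le_b: "(INF k\<in>{n..}. s k) \<le> b" for n
      using Inf_le[of n "max n M"] b[of "max n M"] by simp
    have ge_a: "a \<le> (SUP k\<in>{n..}. s k)" for n
      using Sup_ge[of n "max n M"] a[of "max n M"] by simp
    have "lower_LIMIT s \<le> b"
      unfolding lower_LIMIT_def by (rule cSUP_least) (use le_b in auto)
    moreover have "a \<le> upper_LIMIT s"
      unfolding upper_LIMIT_def by (rule cINF_greatest) (use ge_a in auto)
    moreover have "a \<le> lower_LIMIT s"
    proof -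
      have "a \<le> (INF k\<in>{M..}. s k)" by (rule cINF_greatest) (use a in auto)
      also have "\<dots> \<le> lower_LIMIT s"
        unfolding lower_LIMIT_def using le_b
        by (intro cSUP_upper) (auto simp: M_def intro: bdd_aboveI[of _ b])
      finally show ?thesis .
    qed
    moreover have "upper_LIMIT s \<le> b"
    proof -
      have "upper_LIMIT s \<le> (SUP k\<in>{M..}. s k)"
        unfolding upper_LIMIT_def using ge_a
        by (intro cINF_lower) (auto simp: M_def intro: bdd_belowI[of _ a])
      also have "\<dots> \<le> b" by (rule cSUP_least) (use b in auto)
      finally show ?thesis .
    qed
    ultimately show ?thesis using val_mono ab by metis
  qed
  have "v = L" if "\<And>e. e > 0 \<Longrightarrow> L - e \<le> v \<and> v \<le> L + e" for v
  proof (rule antisym)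
    show "v \<le> L" by (rule field_le_epsilon) (simp add: that)
    show "L \<le> v" by (rule field_le_epsilon) (use that in \<open>simp add: diff_le_eq\<close>)
  qed
  with main show "val (lower_LIMIT s) = L" "val (upper_LIMIT s) = L" by simp_all
qed

lemma val_decimal_of_rat: "val (decimal_of_rat r) = of_rat r"
proof (rule val_eqI)
  fix k
  have eq: "of_rat r * 10 ^ k = (of_rat (10 ^ k * r) :: real)"
    by (simp add: of_rat_mult of_rat_power mult.commute)
  have "of_rat (of_int \<lfloor>10 ^ k * r\<rfloor>) \<le> (of_rat (10 ^ k * r) :: real)"
    "of_rat (10 ^ k * r) \<le> (of_rat (of_int \<lfloor>10 ^ k * r\<rfloor> + 1) :: real)"
    unfolding of_rat_less_eq by linarith+
  then show "of_int (scaled (decimal_of_rat r) k) \<le> (of_rat r * 10 ^ k :: real)"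
    "(of_rat r * 10 ^ k :: real) \<le> of_int (scaled (decimal_of_rat r) k) + 1"
    by (simp_all add: eq scaled_decimal_of_rat of_rat_add)
qed

section \<open>Multiplication\<close>

lift_definition Psi :: "decimal \<Rightarrow> decimal"
  is "\<lambda>x k. if k = 0 then - 1 - x 0 else 9 - x k"
  by auto

definition dnorm :: "decimal \<Rightarrow> decimal" where
  "dnorm x = max x (Psi x)"

text \<open>The two cases of the sign are complementary, see \<open>dsign_eq_1_iff\<close> below.\<close>

definition dsign :: "decimal \<Rightarrow> nat" where
  "dsign x = (if x \<ge> decimal_of_rat 0 then 0 else 1)"

definition dmult :: "decimal \<Rightarrow> decimal \<Rightarrow> decimal"  (infixl "\<otimes>" 70) where
  "x \<otimes> y = (Psi ^^ (dsign x + dsign y))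
     (LIMIT (\<lambda>k. decimal_of_rat (trunc (dnorm x) k * trunc (dnorm y) k)))"

lemma scaled_Psi: "scaled (Psi x) k = - 1 - scaled x k"
  by (induction k) (simp_all add: Psi.rep_eq)

lemma val_Psi: "val (Psi x) = - val x"
  by (rule val_eqI) (use val_bounds[of x] in \<open>auto simp: scaled_Psi algebra_simps\<close>)

lemma scaled_zero: "scaled (decimal_of_rat 0) k = 0"
  by (simp add: scaled_decimal_of_rat)

lemma digit_zero: "digit (decimal_of_rat 0) k = 0"
  using scaled_zero[of k] scaled_zero[of "k - 1"] by (cases k) simp_all

lemma scaled_nonneg_iff: "0 \<le> scaled x k \<longleftrightarrow> 0 \<le> digit x 0"
proof (induction k)
  case (Suc k)
  have "0 \<le> 10 * scaled x k + digit x (Suc k) \<longleftrightarrow> 0 \<le> scaled x k"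
    using digit_bounds[of x k] by linarith
  with Suc show ?case by simp
qed simp

lemma decimal_sign_cases:
  obtains (nonneg) "decimal_of_rat 0 \<le> x" "\<And>k. 0 \<le> scaled x k"
  | (neg) "\<not> decimal_of_rat 0 \<le> x" "\<And>k. scaled x k \<le> - 1"
proof (cases "0 \<le> digit x 0")
  case True
  then have *: "0 \<le> scaled x k" for k by (simp add: scaled_nonneg_iff)
  then show thesis by (intro nonneg) (simp_all add: le_decimal_iff scaled_zero)
next
  case False
  then have *: "\<not> 0 \<le> scaled x k" for k by (simp add: scaled_nonneg_iff)
  then have "scaled x k \<le> - 1" for k using *[of k] by linarith
  then show thesis using * by (intro neg) (simp_all add: le_decimal_iff scaled_zero)
qed

lemma dsign_eq_1_iff: "dsign x = 1 \<longleftrightarrow> x \<le> Psi (decimal_of_rat 0)"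
proof (cases x rule: decimal_sign_cases)
  case nonneg
  then have "\<not> scaled x 0 \<le> scaled (Psi (decimal_of_rat 0)) 0"
    using nonneg(2)[of 0] unfolding scaled_Psi scaled_zero by linarith
  then have "\<not> x \<le> Psi (decimal_of_rat 0)" unfolding le_decimal_iff by blast
  with nonneg(1) show ?thesis by (simp add: dsign_def)
next
  case neg
  then show ?thesis by (simp add: dsign_def le_decimal_iff[of x] scaled_Psi scaled_zero)
qed

lemma dnorm_cases:
  obtains "decimal_of_rat 0 \<le> x" "dnorm x = x"
  | "\<not> decimal_of_rat 0 \<le> x" "dnorm x = Psi x" "decimal_of_rat 0 \<le> Psi x"
proof (cases x rule: decimal_sign_cases)
  case nonneg
  have "scaled (Psi x) k \<le> scaled x k" for k
    using nonneg(2)[of k] unfolding scaled_Psi by linarith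
  then have "dnorm x = x" by (simp add: dnorm_def max_absorb1 le_decimal_iff)
  with nonneg(1) show thesis by (rule that(1))
next
  case neg
  have "scaled x k \<le> scaled (Psi x) k" "0 \<le> scaled (Psi x) k" for k
    using neg(2)[of k] unfolding scaled_Psi by linarith+
  then have "dnorm x = Psi x" "decimal_of_rat 0 \<le> Psi x"
    by (simp_all add: dnorm_def max_absorb2 le_decimal_iff scaled_zero)
  with neg(1) show thesis by (rule that(2))
qed

lemma dnorm_nonneg: "decimal_of_rat 0 \<le> dnorm x"
  by (cases x rule: dnorm_cases) simp_all

lemma val_dnorm: "val (dnorm x) = (- 1) ^ dsign x * val x"
  by (cases x rule: dnorm_cases) (simp_all add: dsign_def val_Psi)

lemma trunc_tendsto_val: "(\<lambda>k. of_rat (trunc x k)) \<longlonglongrightarrow> val x"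
proof (rule real_tendsto_sandwich)
  have eq: "(of_rat (trunc x k) :: real) = of_int (scaled x k) / 10 ^ k" for k
    by (simp add: trunc_scaled of_rat_divide of_rat_power)
  have "val x \<le> (of_int (scaled x k) + 1) / 10 ^ k" for k
    using val_bounds(2)[of x k] by (simp add: pos_le_divide_eq)
  then have "val x - (1 / 10) ^ k \<le> of_rat (trunc x k)" for k
    by (simp add: eq power_one_over add_divide_distrib diff_le_eq)
  then show "\<forall>\<^sub>F k in sequentially. val x - (1 / 10) ^ k \<le> of_rat (trunc x k)" by simp
  have "of_rat (trunc x k) \<le> val x" for k
    using val_bounds(1)[of x k] by (simp add: eq pos_divide_le_eq)
  then show "\<forall>\<^sub>F k in sequentially. of_rat (trunc x k) \<le> val x" by simp
  have "(\<lambda>k. val x - (1 / 10) ^ k) \<longlonglongrightarrow> val x - 0"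
    by (intro tendsto_intros LIMSEQ_power_zero) auto
  then show "(\<lambda>k. val x - (1 / 10) ^ k) \<longlonglongrightarrow> val x" by simp
qed simp

lemma trunc_mono: "m \<le> n \<Longrightarrow> trunc x m \<le> trunc x n"
proof (induction n rule: dec_induct)
  case (step n)
  then show ?case using digit_bounds[of x n] by (simp add: trunc_def add_increasing2)
qed simp

lemma product_sequence:
  fixes x y :: decimal
  defines "s \<equiv> \<lambda>k. decimal_of_rat (trunc (dnorm x) k * trunc (dnorm y) k)"
  shows "upper_LIMIT s = lower_LIMIT s" and "val (LIMIT s) = val (dnorm x) * val (dnorm y)"
proof -
  have lim: "(\<lambda>n. val (s n)) \<longlonglongrightarrow> val (dnorm x) * val (dnorm y)"
    unfolding s_def val_decimal_of_rat of_rat_mult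
    by (intro tendsto_mult trunc_tendsto_val)
  have nonneg: "0 \<le> trunc (dnorm x) k" for x k
    using dnorm_nonneg[of x] by (simp add: trunc_scaled le_decimal_iff scaled_zero)
  have "s m \<le> s n" if "m \<le> n" for m n
    unfolding s_def using that nonneg
    by (intro decimal_of_rat_mono mult_mono trunc_mono)
  then show eq: "upper_LIMIT s = lower_LIMIT s"
    using val_LIMIT(1)[OF lim] by (intro LIMIT_incseq)
  show "val (LIMIT s) = val (dnorm x) * val (dnorm y)"
    using LIMIT_eq[OF eq] val_LIMIT(2)[OF lim] by simp
qed

lemma val_dmult: "val (x \<otimes> y) = val x * val y"
proof -
  have "val ((Psi ^^ n) z) = (- 1) ^ n * val z" for n z
    by (induction n) (simp_all add: val_Psi)
  then show ?thesis
    by (simp add: dmult_def product_sequence(2) val_dnorm power_add)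
      (simp add: dsign_def)
qed

lift_definition dreal_mult :: "dreal \<Rightarrow> dreal \<Rightarrow> dreal"  (infixl "\<otimes>\<^sub>R" 70) is dmult
  by (simp add: no_gap_iff_val val_dmult)

section \<open>Cauchy sequences of rational numbers\<close>

definition CR :: "(nat \<Rightarrow> rat) set" where
  "CR = {x. \<forall>\<epsilon>>0. \<exists>N\<ge>1. \<forall>m\<ge>N. \<forall>n\<ge>N. \<bar>x m - x n\<bar> < \<epsilon>}"

definition CR_mult :: "(nat \<Rightarrow> rat) \<Rightarrow> (nat \<Rightarrow> rat) \<Rightarrow> (nat \<Rightarrow> rat)"  (infixl "\<otimes>\<^sub>C" 70) where
  "x \<otimes>\<^sub>C y = (\<lambda>n. x n * y n)"

text \<open>The upper limit gives the same class on \<^const>\<open>CR\<close>, see \<open>kappa_upper\<close>.\<close>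

definition kappa :: "(nat \<Rightarrow> rat) \<Rightarrow> dreal" where
  "kappa x = class_of (lower_LIMIT (\<lambda>n. decimal_of_rat (x n)))"

lemma dist_of_rat: "dist (of_rat p) (of_rat q :: real) = of_rat \<bar>p - q\<bar>"
  by (simp only: dist_real_def abs_of_rat[symmetric] of_rat_diff)

lemma CR_iff_Cauchy: "x \<in> CR \<longleftrightarrow> Cauchy (\<lambda>n. of_rat (x n) :: real)"
proof
  assume x: "x \<in> CR"
  show "Cauchy (\<lambda>n. of_rat (x n) :: real)"
  proof (rule metric_CauchyI)
    fix e :: real assume "e > 0"
    then obtain q where q: "0 < (of_rat q :: real)" "of_rat q < e" using of_rat_dense[of 0 e] by auto
    then have "q > 0" by simp
    with x obtain N where N: "\<And>m n. m \<ge> N \<Longrightarrow> n \<ge> N \<Longrightarrow> \<bar>x m - x n\<bar> < q"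
      unfolding CR_def by blast
    have "dist (of_rat (x m)) (of_rat (x n) :: real) < e" if "m \<ge> N" "n \<ge> N" for m n
    proof -
      have "(of_rat \<bar>x m - x n\<bar> :: real) < of_rat q" using N[OF that] by (simp only: of_rat_less)
      with q(2) show ?thesis by (simp only: dist_of_rat)
    qed
    then show "\<exists>M. \<forall>m\<ge>M. \<forall>n\<ge>M. dist (of_rat (x m)) (of_rat (x n) :: real) < e" by blast
  qed
next
  assume c: "Cauchy (\<lambda>n. of_rat (x n) :: real)"
  have "\<exists>N\<ge>1. \<forall>m\<ge>N. \<forall>n\<ge>N. \<bar>x m - x n\<bar> < q" if "q > 0" for q
  proof -
    have "0 < (of_rat q :: real)" using that by simp
    from metric_CauchyD[OF c this] obtain N where
      N: "\<And>m n. m \<ge> N \<Longrightarrow> n \<ge> N \<Longrightarrow> dist (of_rat (x m)) (of_rat (x n) :: real) < of_rat q"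
      by blast
    have "\<bar>x m - x n\<bar> < q" if "m \<ge> max N 1" "n \<ge> max N 1" for m n
    proof -
      have "(of_rat \<bar>x m - x n\<bar> :: real) < of_rat q"
        using N[of m n] that unfolding dist_of_rat by simp
      then show ?thesis by (simp only: of_rat_less)
    qed
    then show ?thesis by (intro exI[of _ "max N 1"]) simp
  qed
  then show "x \<in> CR" by (simp add: CR_def)
qed

lemma CR_mult_closed: "x \<in> CR \<Longrightarrow> y \<in> CR \<Longrightarrow> x \<otimes>\<^sub>C y \<in> CR"
  by (simp add: CR_iff_Cauchy CR_mult_def of_rat_mult Cauchy_convergent_iff convergent_mult)

lemma kappa_upper:
  assumes "x \<in> CR"
  shows "kappa x = class_of (upper_LIMIT (\<lambda>n. decimal_of_rat (x n)))"
proof -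
  obtain L where "(\<lambda>n. val (decimal_of_rat (x n))) \<longlonglongrightarrow> L"
    using assms by (auto simp: CR_iff_Cauchy Cauchy_convergent_iff convergent_def val_decimal_of_rat)
  from val_LIMIT(2,3)[OF this] show ?thesis
    by (simp add: kappa_def dreal.abs_eq_iff no_gap_iff_val)
qed

end

theory Submission
  imports Defs
begin

text \<open>Transport everything to the reals: two decimals are identified exactly when they have the
  same value, the value of \<open>lower_LIMIT\<close> is the limit of the values, and the value is
  multiplicative.  So the claim is that the limit of a product is the product of the limits.\<close>

text \<open>Completeness of \<open>real\<close> gives the Cauchy sequence a limit \<open>L\<close>.
  As \<open>val\<close> sends an embedded rational to that rational, \<open>val_LIMIT\<close>
  identifies \<open>L\<close> with the value of the lower limit.\<close>

lemma val_lower_LIMIT_tendsto: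
  assumes "x \<in> CR"
  shows "(\<lambda>n. of_rat (x n)) \<longlonglongrightarrow> val (lower_LIMIT (\<lambda>n. decimal_of_rat (x n)))"
proof -
  obtain L where L: "(\<lambda>n. of_rat (x n) :: real) \<longlonglongrightarrow> L"
    using assms by (auto simp: CR_iff_Cauchy Cauchy_convergent_iff convergent_def)
  then have "val (lower_LIMIT (\<lambda>n. decimal_of_rat (x n))) = L"
    by (intro val_LIMIT(2)) (simp add: val_decimal_of_rat)
  with L show ?thesis by simp
qed

theorem theorem7p6:
  fixes x y :: "nat \<Rightarrow> rat"
  assumes "x \<in> CR" and "y \<in> CR"
  shows "kappa (x \<otimes>\<^sub>C y) = kappa x \<otimes>\<^sub>R kappa y"
proof -
  let ?l = "\<lambda>x. lower_LIMIT (\<lambda>n. decimal_of_rat (x n))"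
  have "(\<lambda>n. of_rat ((x \<otimes>\<^sub>C y) n)) \<longlonglongrightarrow> val (?l x) * val (?l y)"
    using tendsto_mult[OF assms[THEN val_lower_LIMIT_tendsto]]
    by (simp add: CR_mult_def of_rat_mult)
  \<comment> \<open>The termwise product is again in \<open>CR\<close>, so its values also tend to
    the value of its own lower limit: one real sequence with two limits.\<close>
  with val_lower_LIMIT_tendsto[OF CR_mult_closed[OF assms]]
  have "val (?l (x \<otimes>\<^sub>C y)) = val (?l x \<otimes> ?l y)"
    unfolding val_dmult by (rule LIMSEQ_unique)
  then show ?thesis
    by (simp add: kappa_def dreal_mult.abs_eq dreal.abs_eq_iff no_gap_iff_val)
qed

end
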